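(* Let $\mathcal S\subseteq\mathcal S_{0,\infty}$ be either a singleton $\{\sigma\}$ or a family of impulse sequences, and suppose that $\bar T:=\sup_{\sigma\in\mathcal S}\sup_{k\ge0}(t_{k+1}-t_k)=\infty$. Suppose that there exist $M\ge1$, $\alpha>0$, $\rho\in(0,1)$ such that $\|U_\sigma(t,s)\|\le M\rho^{\kappa_\sigma(t,s)}e^{-\alpha(t-s)}$ for all $t\ge s\ge0$ and all $\sigma\in\mathcal S$ (i.e. the system is GES for $\sigma$, respectively UGES over $\mathcal S$, with these constants). Then the semigroup is exponentially stable: $$\|S(\tau)\|\le Me^{-\alpha\tau}\qquad\text{for all }\tau\ge0.$$ In particular the growth bound of $S$ is at most $-\alpha<0$. Moreover, the growth condition (defined in the context) then holds for $\mathcal S$ with $G=M_0$, where $M_0\ge1$ is a constant such that $\|S(t)\|\le M_0e^{\omega t}$ for all $t\ge0$ and some $\omega\le0$.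
   Context: Setting. $X$ is a Banach space with norm $\|\cdot\|$; $A:D(A)\subset X\to X$ generates a strongly continuous ($C_0$) semigroup $(S(t))_{t\ge0}$ on $X$; $J\in L(X)$ is bounded, $J\neq0$, $JD(A)\subset D(A)$. $\mathcal S_{0,\infty}$ is the set of sequences $\sigma=\{t_k\}_{k\ge1}$ with, setting $t_0:=0$, $t_{k+1}>t_k$ for all $k\ge0$ and $t_k\to\infty$; $\mathbb T_\sigma:=\{t_k:k\ge1\}$. The impulsive system is $\dot x(t)=Ax(t)$ for $t\notin\mathbb T_\sigma$, $x(t)=Jx(t^-)$ for $t\in\mathbb T_\sigma$. Its propagator $U_\sigma(t,s)$, $t\ge s\ge0$, is: $U_\sigma(t,s)=S(t-s)$ if $(s,t]\cap\mathbb T_\sigma=\varnothing$; otherwise, if $t_l<\dots<t_m$ are the impulse times in $(s,t]$, $U_\sigma(t,s)=S(t-t_m)JS(t_m-t_{m-1})J\cdots JS(t_l-s)$. $\kappa_\sigma(t,s):=\#(\mathbb T_\sigma\cap(s,t])$. Growth condition for $\mathcal S$: there exist a piecewise continuous $g:\mathbb R_{\ge0}\to\mathbb R_{>0}$ bounded below by some $c_0>0$, and $\mu>1$, such that $\|U_\sigma(t,s)x\|\le g(t-s)\mu^{\kappa_\sigma(t,s)}\|x\|$ for all $t\ge s\ge0$, $x\in X$, $\sigma\in\mathcal S$, and $G:=\sup_{0\le\tau<\bar T}g(\tau)<\infty$. The growth bound of $S$ is the infimum of all $\omega\in\mathbb R$ for which there is $M'\ge1$ with $\|S(t)\|\le M'e^{\omega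 t}$ for all $t\ge0$. *)

theory Defs
  imports "HOL-Analysis.Analysis"
begin

text \<open>Semigroups are functions on all of \<^typ>\<open>real\<close>; only their values at nonnegative
  times are constrained or used.\<close>

definition C0_semigroup :: "(real \<Rightarrow> 'a::banach \<Rightarrow>\<^sub>L 'a) \<Rightarrow> bool" where
  "C0_semigroup S \<longleftrightarrow>
     S 0 = id_blinfun \<and>
     (\<forall>s\<ge>0. \<forall>t\<ge>0. S (s + t) = S s o\<^sub>L S t) \<and>
     (\<forall>x. ((\<lambda>t. blinfun_apply (S t) x) \<longlongrightarrow> x) (at_right 0))"

definition is_generator :: "(real \<Rightarrow> 'a::banach \<Rightarrow>\<^sub>L 'a) \<Rightarrow> 'a set \<Rightarrow> ('a \<Rightarrow> 'a) \<Rightarrow> bool" where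
  "is_generator S D A \<longleftrightarrow>
     D = {x. \<exists>y. ((\<lambda>h. (blinfun_apply (S h) x - x) /\<^sub>R h) \<longlongrightarrow> y) (at_right 0)} \<and>
     (\<forall>x\<in>D. ((\<lambda>h. (blinfun_apply (S h) x - x) /\<^sub>R h) \<longlongrightarrow> A x) (at_right 0))"

text \<open>The infimum is taken in the extended reals, as it is \<open>-\<infinity>\<close> e.g. for nilpotent semigroups.\<close>

definition growth_bound :: "(real \<Rightarrow> 'a::banach \<Rightarrow>\<^sub>L 'a) \<Rightarrow> ereal" where
  "growth_bound S =
     Inf {ereal \<omega> | \<omega>. \<exists>M'\<ge>1. \<forall>t\<ge>0. norm (S t) \<le> M' * exp (\<omega> * t)}"

text \<open>An impulse sequence \<open>(t\<^sub>k)\<close>, \<open>k \<ge> 1\<close>, is stored together with the convention \<open>t\<^sub>0 = 0\<close>;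
  the value at index 0 is not an impulse time.\<close>

definition impulse_seqs :: "(nat \<Rightarrow> real) set" where
  "impulse_seqs = {\<sigma>. \<sigma> 0 = 0 \<and> (\<forall>k. \<sigma> k < \<sigma> (Suc k)) \<and> filterlim \<sigma> at_top sequentially}"

definition impulse_times :: "(nat \<Rightarrow> real) \<Rightarrow> real set" where
  "impulse_times \<sigma> = \<sigma> ` {1..}"

definition num_impulses :: "(nat \<Rightarrow> real) \<Rightarrow> real \<Rightarrow> real \<Rightarrow> nat" where
  "num_impulses \<sigma> t s = card (impulse_times \<sigma> \<inter> {s<..t})"

definition sup_gap :: "(nat \<Rightarrow> real) set \<Rightarrow> ereal" where
  "sup_gap \<S> = (SUP \<sigma>\<in>\<S>. SUP k. ereal (\<sigma> (Suc k) - \<sigma> k))"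

text \<open>\<open>evolve S J [r\<^sub>1, \<dots>, r\<^sub>n] t s\<close> is \<open>S(t - r\<^sub>n) J S(r\<^sub>n - r\<^sub>n\<^sub>-\<^sub>1) J \<cdots> J S(r\<^sub>1 - s)\<close>.\<close>

fun evolve :: "(real \<Rightarrow> 'a::banach \<Rightarrow>\<^sub>L 'a) \<Rightarrow> ('a \<Rightarrow>\<^sub>L 'a) \<Rightarrow> real list \<Rightarrow> real \<Rightarrow> real \<Rightarrow> 'a \<Rightarrow>\<^sub>L 'a" where
  "evolve S J [] t s = S (t - s)"
| "evolve S J (r # rs) t s = evolve S J rs t r o\<^sub>L J o\<^sub>L S (r - s)"

text \<open>For \<^term>\<open>\<sigma> \<in> impulse_seqs\<close> the set below is finite because \<open>\<sigma>\<close> tends to infinity, so the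
  list enumerates the impulse times in \<open>(s, t]\<close> increasingly.\<close>

definition propagator ::
  "(real \<Rightarrow> 'a::banach \<Rightarrow>\<^sub>L 'a) \<Rightarrow> ('a \<Rightarrow>\<^sub>L 'a) \<Rightarrow> (nat \<Rightarrow> real) \<Rightarrow> real \<Rightarrow> real \<Rightarrow> 'a \<Rightarrow>\<^sub>L 'a" where
  "propagator S J \<sigma> t s =
     evolve S J (sorted_list_of_set (impulse_times \<sigma> \<inter> {s<..t})) t s"

text \<open>Piecewise continuity on \<open>[0, \<infinity>)\<close>: finitely many discontinuities in each bounded interval,
  with finite one-sided limits everywhere.\<close>

definition piecewise_continuous_nonneg :: "(real \<Rightarrow> real) \<Rightarrow> bool" where
  "piecewise_continuous_nonneg g \<longleftrightarrow>
     (\<forall>b\<ge>0. finite {t \<in> {0..b}. \<not> continuous (at t within {0..}) g}) \<and>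
     (\<forall>t\<ge>0. \<exists>l. (g \<longlongrightarrow> l) (at_right t)) \<and>
     (\<forall>t>0. \<exists>l. (g \<longlongrightarrow> l) (at_left t))"

definition growth_sup :: "(nat \<Rightarrow> real) set \<Rightarrow> (real \<Rightarrow> real) \<Rightarrow> ereal" where
  "growth_sup \<S> g = (SUP \<tau> \<in> {\<tau>. 0 \<le> \<tau> \<and> ereal \<tau> < sup_gap \<S>}. ereal (g \<tau>))"

definition growth_condition ::
  "(real \<Rightarrow> 'a::banach \<Rightarrow>\<^sub>L 'a) \<Rightarrow> ('a \<Rightarrow>\<^sub>L 'a) \<Rightarrow> (nat \<Rightarrow> real) set \<Rightarrow> (real \<Rightarrow> real) \<Rightarrow> real \<Rightarrow> bool" where
  "growth_condition S J \<S> g \<mu> \<longleftrightarrow>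
     piecewise_continuous_nonneg g \<and>
     (\<forall>\<tau>\<ge>0. g \<tau> > 0) \<and>
     (\<exists>c\<^sub>0>0. \<forall>\<tau>\<ge>0. c\<^sub>0 \<le> g \<tau>) \<and>
     \<mu> > 1 \<and>
     (\<forall>\<sigma>\<in>\<S>. \<forall>s\<ge>0. \<forall>t\<ge>s. \<forall>x.
        norm (blinfun_apply (propagator S J \<sigma> t s) x) \<le> g (t - s) * \<mu> ^ num_impulses \<sigma> t s * norm x) \<and>
     growth_sup \<S> g < \<infinity>"

end

theory Submission
  imports Defs
begin

text \<open>The impulses are invisible to the propagator between two consecutive impulse times: on a
  window \<open>(s, s + \<tau>]\<close> inside a gap, \<open>U(s + \<tau>, s)\<close> is the free evolution \<open>S \<tau>\<close> and the number of
  impulses is zero, so the uniform estimate for \<open>U\<close> at that window is the desired estimate for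
  \<open>S \<tau>\<close> with the same constants \<open>M\<close> and \<open>\<alpha>\<close>. Unbounded gaps provide such a window for every
  length \<open>\<tau>\<close> (\<open>gap_longer_than\<close>, \<open>propagator_within_gap\<close>), so the semigroup itself is exponentially
  stable.

  For the growth condition, the constant function \<open>g = M\<^sub>0\<close> suffices. On windows without impulses
  the bound is the one assumed for the semigroup. On windows with at least one impulse the stability
  estimate gives \<open>\<parallel>U\<parallel> \<le> M\<close>, and a single factor \<open>\<mu> = M + 1\<close> already absorbs \<open>M\<close>
  (\<open>growth_condition_const\<close>).\<close>

lemma finite_impulse_times_Int:
  assumes "\<sigma> \<in> impulse_seqs"
  shows "finite (impulse_times \<sigma> \<inter> {s<..t})"
proof -
  have "eventually (\<lambda>k. t < \<sigma> k) sequentially"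
    using assms by (simp add: impulse_seqs_def filterlim_at_top_dense)
  then obtain N where N: "\<And>k. k \<ge> N \<Longrightarrow> t < \<sigma> k"
    by (auto simp: eventually_sequentially)
  have "k < N" if "\<sigma> k \<le> t" for k
    using N[of k] that by (cases "k < N") auto
  then have "impulse_times \<sigma> \<inter> {s<..t} \<subseteq> \<sigma> ` {..<N}"
    by (auto simp: impulse_times_def)
  then show ?thesis
    by (rule finite_subset) simp
qed

text \<open>The hypothesis on \<open>\<sigma>\<close> excludes the junk value of \<^const>\<open>card\<close>: it makes the set of impulse
  times finite, so a zero count does mean an empty set.\<close>

lemma propagator_eq_semigroup:
  assumes "\<sigma> \<in> impulse_seqs" and "num_impulses \<sigma> t s = 0"
  shows "propagator S J \<sigma> t s = S (t - s)"
proof -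
  have "impulse_times \<sigma> \<inter> {s<..t} = {}"
    using assms finite_impulse_times_Int[OF assms(1)] by (simp add: num_impulses_def)
  then show ?thesis
    by (simp add: propagator_def)
qed

lemma num_impulses_within_gap:
  assumes "\<sigma> \<in> impulse_seqs" and "t < \<sigma> (Suc k)"
  shows "num_impulses \<sigma> t (\<sigma> k) = 0"
proof -
  have mono: "strict_mono \<sigma>"
    using assms(1) by (simp add: impulse_seqs_def strict_mono_Suc_iff)
  have "\<not> (\<sigma> k < \<sigma> j \<and> \<sigma> j \<le> t)" for j
  proof
    assume j: "\<sigma> k < \<sigma> j \<and> \<sigma> j \<le> t"
    then have "\<sigma> j < \<sigma> (Suc k)"
      using assms(2) by simp
    with j show False
      by (simp add: strict_mono_less[OF mono])
  qed
  then have "impulse_times \<sigma> \<inter> {\<sigma> k<..t} = {}"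
    by (auto simp: impulse_times_def)
  then show ?thesis
    by (simp add: num_impulses_def)
qed

lemma propagator_within_gap:
  assumes "\<sigma> \<in> impulse_seqs" and "\<tau> < \<sigma> (Suc k) - \<sigma> k"
  shows "num_impulses \<sigma> (\<sigma> k + \<tau>) (\<sigma> k) = 0"
    and "propagator S J \<sigma> (\<sigma> k + \<tau>) (\<sigma> k) = S \<tau>"
proof -
  show zero: "num_impulses \<sigma> (\<sigma> k + \<tau>) (\<sigma> k) = 0"
    using assms by (intro num_impulses_within_gap) auto
  show "propagator S J \<sigma> (\<sigma> k + \<tau>) (\<sigma> k) = S \<tau>"
    using propagator_eq_semigroup[OF assms(1) zero] by simp
qed

lemma impulse_seqs_nonneg:
  assumes "\<sigma> \<in> impulse_seqs"
  shows "0 \<le> \<sigma> k"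
proof -
  have "strict_mono \<sigma>" and "\<sigma> 0 = 0"
    using assms by (simp_all add: impulse_seqs_def strict_mono_Suc_iff)
  then show ?thesis
    using strict_mono_less_eq[of \<sigma> 0 k] by simp
qed

lemma gap_longer_than:
  assumes "ereal \<tau> < sup_gap \<S>"
  obtains \<sigma> k where "\<sigma> \<in> \<S>" and "\<tau> < \<sigma> (Suc k) - \<sigma> k"
  using assms by (auto simp: sup_gap_def less_SUP_iff)

text \<open>Every \<open>\<tau>\<close> below the supremum of the gaps is the length of some window inside a gap, where the
  propagator coincides with the semigroup and counts no impulse; hence the value of \<open>c\<close> at \<open>0\<close>.\<close>

lemma semigroup_bound_of_propagator_bound:
  assumes "\<S> \<subseteq> impulse_seqs"
    and bound: "\<And>\<sigma> s t. \<sigma> \<in> \<S> \<Longrightarrow> 0 \<le> s \<Longrightarrow> s \<le> t \<Longrightarrow>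
           norm (propagator S J \<sigma> t s) \<le> c (num_impulses \<sigma> t s) (t - s)"
    and "0 \<le> \<tau>" and "ereal \<tau> < sup_gap \<S>"
  shows "norm (S \<tau>) \<le> c 0 \<tau>"
proof -
  obtain \<sigma> k where \<sigma>: "\<sigma> \<in> \<S>" and gap: "\<tau> < \<sigma> (Suc k) - \<sigma> k"
    using gap_longer_than[OF assms(4)] .
  have seq: "\<sigma> \<in> impulse_seqs"
    using \<sigma> assms(1) by auto
  show ?thesis
    using bound[OF \<sigma> impulse_seqs_nonneg[OF seq, of k], of "\<sigma> k + \<tau>"] \<open>0 \<le> \<tau>\<close>
    by (simp add: propagator_within_gap[OF seq gap])
qed

lemma growth_bound_le:
  assumes "M \<ge> 1" and "\<And>t. t \<ge> 0 \<Longrightarrow> norm (S t) \<le> M * exp (\<omega> * t)"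
  shows "growth_bound S \<le> ereal \<omega>"
  unfolding growth_bound_def using assms by (intro Inf_lower) auto

lemma growth_sup_const:
  assumes "0 < sup_gap \<S>"
  shows "growth_sup \<S> (\<lambda>_. c) = ereal c"
proof -
  have "0 \<in> {\<tau>. 0 \<le> \<tau> \<and> ereal \<tau> < sup_gap \<S>}"
    using assms by (simp add: zero_ereal_def)
  then show ?thesis
    unfolding growth_sup_def by (intro SUP_const) blast
qed

lemma piecewise_continuous_nonneg_const: "piecewise_continuous_nonneg (\<lambda>_. c)"
  unfolding piecewise_continuous_nonneg_def
  by (intro conjI allI impI exI[of _ c]) simp_all

text \<open>A uniformly bounded propagator costs only one factor \<open>\<mu>\<close>, paid at the first impulse;
  \<open>M + 1\<close> instead of \<open>M\<close> makes \<open>\<mu> > 1\<close> strict when \<open>M = 1\<close>.\<close>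

lemma growth_condition_const:
  assumes "\<S> \<subseteq> impulse_seqs" and "0 < sup_gap \<S>" and "M \<ge> 1" and "M\<^sub>0 \<ge> 1"
    and U: "\<And>\<sigma> s t. \<sigma> \<in> \<S> \<Longrightarrow> 0 \<le> s \<Longrightarrow> s \<le> t \<Longrightarrow> norm (propagator S J \<sigma> t s) \<le> M"
    and S: "\<And>t. t \<ge> 0 \<Longrightarrow> norm (S t) \<le> M\<^sub>0"
  shows "growth_condition S J \<S> (\<lambda>_. M\<^sub>0) (M + 1)"
proof -
  have op: "norm (propagator S J \<sigma> t s) \<le> M\<^sub>0 * (M + 1) ^ num_impulses \<sigma> t s"
    if "\<sigma> \<in> \<S>" "0 \<le> s" "s \<le> t" for \<sigma> s t
  proof (cases "num_impulses \<sigma> t s = 0")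
    case True
    then show ?thesis
      using that assms(1) S[of "t - s"] by (simp add: propagator_eq_semigroup subset_iff)
  next
    case False
    have "norm (propagator S J \<sigma> t s) \<le> (M + 1) ^ 1"
      using U[OF that] by simp
    also have "\<dots> \<le> (M + 1) ^ num_impulses \<sigma> t s"
      using False \<open>M \<ge> 1\<close> by (intro power_increasing) auto
    also have "\<dots> \<le> M\<^sub>0 * (M + 1) ^ num_impulses \<sigma> t s"
      using \<open>M \<ge> 1\<close> \<open>M\<^sub>0 \<ge> 1\<close> mult_right_mono[of 1 "M\<^sub>0" "(M + 1) ^ num_impulses \<sigma> t s"] by simp
    finally show ?thesis .
  qed
  have "norm (propagator S J \<sigma> t s x) \<le> M\<^sub>0 * (M + 1) ^ num_impulses \<sigma> t s * norm x"
    if "\<sigma> \<in> \<S>" "0 \<le> s" "s \<le> t" for \<sigma> s t x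
    using norm_blinfun[of "propagator S J \<sigma> t s" x] mult_right_mono[OF op[OF that] norm_ge_zero]
    by (rule order_trans)
  moreover have "\<exists>c>0. \<forall>\<tau>\<ge>0::real. c \<le> M\<^sub>0"
    using \<open>M\<^sub>0 \<ge> 1\<close> by (intro exI[of _ M\<^sub>0]) simp
  ultimately show ?thesis
    using assms(2-4)
    by (simp add: growth_condition_def growth_sup_const piecewise_continuous_nonneg_const)
qed

theorem proposition3p3:
  fixes S :: "real \<Rightarrow> 'a::banach \<Rightarrow>\<^sub>L 'a"
    and D :: "'a set" and A :: "'a \<Rightarrow> 'a"
    and J :: "'a \<Rightarrow>\<^sub>L 'a"
    and \<S> :: "(nat \<Rightarrow> real) set"
    and M \<alpha> \<rho> :: real
  assumes "C0_semigroup S" and "is_generator S D A"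
    and "J \<noteq> 0" and "blinfun_apply J ` D \<subseteq> D"
    and "\<S> \<subseteq> impulse_seqs"
    and "sup_gap \<S> = \<infinity>"
    and "M \<ge> 1" and "\<alpha> > 0" and "\<rho> \<in> {0<..<1}"
    and "\<And>\<sigma> s t. \<sigma> \<in> \<S> \<Longrightarrow> 0 \<le> s \<Longrightarrow> s \<le> t \<Longrightarrow>
           norm (propagator S J \<sigma> t s) \<le> M * \<rho> ^ num_impulses \<sigma> t s * exp (- \<alpha> * (t - s))"
  shows "(\<forall>\<tau>\<ge>0. norm (S \<tau>) \<le> M * exp (- \<alpha> * \<tau>)) \<and>
    growth_bound S \<le> ereal (- \<alpha>) \<and> ereal (- \<alpha>) < 0 \<and>
    (\<exists>M\<^sub>0\<ge>1. \<exists>\<omega>\<le>0. \<forall>t\<ge>0. norm (S t) \<le> M\<^sub>0 * exp (\<omega> * t)) \<and>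
    (\<forall>M\<^sub>0\<ge>1. \<forall>\<omega>\<le>0. (\<forall>t\<ge>0. norm (S t) \<le> M\<^sub>0 * exp (\<omega> * t)) \<longrightarrow>
       (\<exists>g \<mu>. growth_condition S J \<S> g \<mu> \<and> growth_sup \<S> g = ereal M\<^sub>0))"
proof -
  have decay: "norm (S \<tau>) \<le> M * exp (- \<alpha> * \<tau>)" if "\<tau> \<ge> 0" for \<tau>
    using semigroup_bound_of_propagator_bound
        [where c = "\<lambda>n r. M * \<rho> ^ n * exp (- \<alpha> * r)", OF assms(5) assms(10) that] assms(6)
    by simp
  have U: "norm (propagator S J \<sigma> t s) \<le> M" if "\<sigma> \<in> \<S>" "0 \<le> s" "s \<le> t" for \<sigma> s t
  proof -
    have "M * (\<rho> ^ num_impulses \<sigma> t s * exp (- \<alpha> * (t - s))) \<le> M * 1"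
      using that assms(7-9) by (intro mult_left_mono mult_le_one power_le_one) auto
    then show ?thesis
      using assms(10)[OF that] by (simp add: mult.assoc)
  qed
  have growth: "\<exists>g \<mu>. growth_condition S J \<S> g \<mu> \<and> growth_sup \<S> g = ereal M\<^sub>0"
    if M\<^sub>0: "M\<^sub>0 \<ge> 1" and "\<omega> \<le> 0" and S: "\<forall>t\<ge>0. norm (S t) \<le> M\<^sub>0 * exp (\<omega> * t)" for M\<^sub>0 \<omega>
  proof -
    have "norm (S t) \<le> M\<^sub>0" if "t \<ge> 0" for t
    proof -
      have "M\<^sub>0 * exp (\<omega> * t) \<le> M\<^sub>0 * 1"
        using M\<^sub>0 \<open>\<omega> \<le> 0\<close> \<open>t \<ge> 0\<close> by (intro mult_left_mono) (auto simp: mult_nonpos_nonneg)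
      then show ?thesis
        using S \<open>t \<ge> 0\<close> by fastforce
    qed
    then have "growth_condition S J \<S> (\<lambda>_. M\<^sub>0) (M + 1)"
      using M\<^sub>0 U assms(5-7) by (intro growth_condition_const) auto
    moreover have "growth_sup \<S> (\<lambda>_. M\<^sub>0) = ereal M\<^sub>0"
      using assms(6) by (intro growth_sup_const) simp
    ultimately show ?thesis
      by blast
  qed
  have "growth_bound S \<le> ereal (- \<alpha>)"
    using assms(7) decay by (rule growth_bound_le)
  moreover have "\<exists>M\<^sub>0\<ge>1. \<exists>\<omega>\<le>0. \<forall>t\<ge>0. norm (S t) \<le> M\<^sub>0 * exp (\<omega> * t)"
    using decay assms(7,8) by (intro exI[of _ M] conjI exI[of _ "- \<alpha>"]) auto
  ultimately show ?thesis
    using decay growth assms(8) by (intro conjI) simp_all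
qed

end
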